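(* Let $\mathcal{K}$ be a complete idempotent semiring and $(Y,X)$ a pre-dual pair for $\mathcal{K}$. (a) Suppose that for every complete polar cone $W\subset X^2$ and every $(s,t)\in X^2\setminus W$ there exists $y\in Y$ such that $\langle y\mid f\rangle\leq\langle y\mid g\rangle$ for all $(f,g)\in W$ and $\langle y\mid s\rangle\not\leq\langle y\mid t\rangle$. Then a subsemimodule $W\subset X^2$ is a complete polar cone if and only if $W=(W^\diamond)^\circ$. (b) Suppose that for every complete congruence $W\subset X^2$ and every $(s,t)\in X^2\setminus W$ there exists $y\in Y$ such that $\langle y\mid f\rangle=\langle y\mid g\rangle$ for all $(f,g)\in W$ and $\langle y\mid s\rangle\neq\langle y\mid t\rangle$. Then a subsemimodule $W\subset X^2$ is a complete congruence if and only if $W=(W^\top)^\bot$.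
   Context: An idempotent semiring $(\mathcal{K},\oplus,\otimes,\varepsilon,e)$ is ordered by the natural order $a\leq b\iff a\oplus b=b$; $\vee Q$ denotes the least upper bound of $Q$. A map $F$ between ordered sets in which every subset has a least upper bound is continuous if $F(\vee Q)=\vee F(Q)$ for all subsets $Q$. $\mathcal{K}$ is complete if every subset has a least upper bound and all left and right multiplications are continuous. A right $\mathcal{K}$-semimodule $X$ is a commutative monoid $(X,\oplus,\varepsilon)$ with a right action satisfying $(x\oplus z)\lambda=x\lambda\oplus z\lambda$, $x(\lambda\oplus\mu)=x\lambda\oplus x\mu$, $x(\lambda\mu)=(x\lambda)\mu$, $x\varepsilon=\varepsilon$, $\varepsilon\lambda=\varepsilon$, $xe=x$; it is then idempotent and naturally ordered by $x\le z\iff x\oplus z=z$. It is complete if every subset has a least upper bound and the maps $z\mapsto z\lambda$ ($X\to X$) and $\mu\mapsto u\mu$ ($\mathcal{K}\to X$) are continuous for all $\lambda\in\mathcal{K}$, $u\in X$. Left semimodules are defined dually. A pre-dual pair $(Y,X)$ for $\mathcal{K}$ consists of a complete right $\mathcal{K}$-semimodule $X$ and a complete left $\mathcal{K}$-semimodule $Y$ with a bracket $\langle\cdot\mid\cdot\rangle:Y\times X\to\mathcal{K}$ such that for all $x\in X$, $y\in Y$ the maps $y\mapsto\langle y\mid x\rangle$ and $x\mapsto\langle y\mid x\rangle$ are respectively left and right linear (preserve finite sums and commute with the scalar action), and continuous. A subsemimodule is a subset stable under all $x\lambda\oplus z\mu$; it is complete if it contains $\vee Q$ for each of its subsets $Q$.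 $X^2$ carries componentwise operations. A pre-congruence is a subsemimodule $W\subset X^2$ with $(f,f)\in W$ for all $f\in X$ and $(f,g),(g,h)\in W\implies(f,h)\in W$. A polar cone is a pre-congruence with $f\leq g\implies(f,g)\in W$; a congruence is a pre-congruence with $(f,g)\in W\implies(g,f)\in W$. Complete polar cones and congruences are those that are complete as subsemimodules. For $W\subset X^2$ and $V\subset Y$: $$W^\diamond=\{y\in Y\mid\langle y\mid f\rangle\leq\langle y\mid g\rangle\ \forall(f,g)\in W\},\quad V^\circ=\{(f,g)\in X^2\mid\langle y\mid f\rangle\leq\langle y\mid g\rangle\ \forall y\in V\},$$ $$W^\top=\{y\in Y\mid\langle y\mid f\rangle=\langle y\mid g\rangle\ \forall(f,g)\in W\},\quad V^\bot=\{(f,g)\in X^2\mid\langle y\mid f\rangle=\langle y\mid g\rangle\ \forall y\in V\}.$$ *)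

theory Defs
  imports "HOL-Library.Product_Plus" "HOL-Library.Product_Order"
begin

text \<open>Continuity refers to suprema of arbitrary subsets, the empty set included, in
  contrast to \<open>sup_continuous\<close> of \<open>HOL-Library.Order_Continuity\<close>, which concerns
  increasing sequences.\<close>

definition lub_continuous :: "('a::complete_lattice \<Rightarrow> 'b::complete_lattice) \<Rightarrow> bool" where
  "lub_continuous F \<longleftrightarrow> (\<forall>Q. F (Sup Q) = Sup (F ` Q))"

text \<open>The order of the library classes is forced to be the natural order, so it carries no
  additional data. Reflexivity yields idempotency of the addition.\<close>

class idem_monoid = comm_monoid_add + order +
  assumes le_iff_add_eq: "a \<le> b \<longleftrightarrow> a + b = b"
begin

lemma add_idem: "a + a = a"
  by (rule iffD1[OF le_iff_add_eq order_refl])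

end

class complete_idem_monoid = idem_monoid + complete_lattice

text \<open>\<open>semiring_0\<close> together with \<open>monoid_mult\<close> is used instead of \<open>semiring_1\<close>, as the
  latter would exclude the semiring with one element.\<close>

class idem_semiring = idem_monoid + semiring_0 + monoid_mult

class complete_idem_semiring = idem_semiring + complete_idem_monoid +
  assumes mult_left_continuous: "a * Sup Q = Sup ((\<lambda>b. a * b) ` Q)"
    and mult_right_continuous: "Sup Q * a = Sup ((\<lambda>b. b * a) ` Q)"

locale right_semimodule =
  fixes ract :: "'x::comm_monoid_add \<Rightarrow> 'k::idem_semiring \<Rightarrow> 'x"
  assumes ract_add_left: "ract (x + z) l = ract x l + ract z l"
    and ract_add_right: "ract x (l + m) = ract x l + ract x m"
    and ract_mult: "ract x (l * m) = ract (ract x l) m"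
    and ract_zero_right: "ract x 0 = 0"
    and ract_zero_left: "ract 0 l = 0"
    and ract_one: "ract x 1 = x"
begin

text \<open>Idempotency is automatic, so that requiring \<open>idem_monoid\<close> below only fixes the order.\<close>

lemma semimodule_add_idem: "x + x = x" for x :: 'x
  using ract_add_right[of x 1 1] unfolding add_idem ract_one by (rule sym)

end

locale left_semimodule =
  fixes lact :: "'k::idem_semiring \<Rightarrow> 'y::comm_monoid_add \<Rightarrow> 'y"
  assumes lact_add_right: "lact l (y + z) = lact l y + lact l z"
    and lact_add_left: "lact (l + m) y = lact l y + lact m y"
    and lact_mult: "lact (l * m) y = lact l (lact m y)"
    and lact_zero_left: "lact 0 y = 0"
    and lact_zero_right: "lact l 0 = 0"
    and lact_one: "lact 1 y = y"

locale complete_right_semimodule = right_semimodule ract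
  for ract :: "'x::complete_idem_monoid \<Rightarrow> 'k::complete_idem_semiring \<Rightarrow> 'x" +
  assumes ract_continuous_left: "lub_continuous (\<lambda>z. ract z l)"
    and ract_continuous_right: "lub_continuous (\<lambda>m. ract u m)"

locale complete_left_semimodule = left_semimodule lact
  for lact :: "'k::complete_idem_semiring \<Rightarrow> 'y::complete_idem_monoid \<Rightarrow> 'y" +
  assumes lact_continuous_right: "lub_continuous (\<lambda>z. lact l z)"
    and lact_continuous_left: "lub_continuous (\<lambda>m. lact m u)"

locale pre_dual_pair =
  complete_left_semimodule lact + complete_right_semimodule ract
  for lact :: "'k::complete_idem_semiring \<Rightarrow> 'y::complete_idem_monoid \<Rightarrow> 'y"
    and ract :: "'x::complete_idem_monoid \<Rightarrow> 'k \<Rightarrow> 'x" +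
  fixes bracket :: "'y \<Rightarrow> 'x \<Rightarrow> 'k"
  assumes bracket_zero_left: "bracket 0 x = 0"
    and bracket_add_left: "bracket (y + z) x = bracket y x + bracket z x"
    and bracket_lact: "bracket (lact l y) x = l * bracket y x"
    and bracket_continuous_left: "lub_continuous (\<lambda>y. bracket y x)"
    and bracket_zero_right: "bracket y 0 = 0"
    and bracket_add_right: "bracket y (f + g) = bracket y f + bracket y g"
    and bracket_ract: "bracket y (ract x l) = bracket y x * l"
    and bracket_continuous_right: "lub_continuous (\<lambda>x. bracket y x)"

definition subsemimodule :: "('x::plus \<Rightarrow> 'k \<Rightarrow> 'x) \<Rightarrow> 'x set \<Rightarrow> bool" where
  "subsemimodule act W \<longleftrightarrow> (\<forall>x\<in>W. \<forall>z\<in>W. \<forall>l m. act x l + act z m \<in> W)"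

definition complete_subsemimodule ::
    "('x::complete_idem_monoid \<Rightarrow> 'k \<Rightarrow> 'x) \<Rightarrow> 'x set \<Rightarrow> bool" where
  "complete_subsemimodule act W \<longleftrightarrow> subsemimodule act W \<and> (\<forall>Q. Q \<subseteq> W \<longrightarrow> Sup Q \<in> W)"

definition square_act :: "('x \<Rightarrow> 'k \<Rightarrow> 'x) \<Rightarrow> 'x \<times> 'x \<Rightarrow> 'k \<Rightarrow> 'x \<times> 'x" where
  "square_act ract p l = (ract (fst p) l, ract (snd p) l)"

text \<open>The componentwise order on pairs is the natural order of the componentwise addition,
  and the square of a complete semimodule is a complete semimodule.\<close>

instance prod :: (idem_monoid, idem_monoid) idem_monoid
  by standard (simp add: less_eq_prod_def le_iff_add_eq prod_eq_iff)

instance prod :: (complete_idem_monoid, complete_idem_monoid) complete_idem_monoid ..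

lemma (in complete_right_semimodule) complete_right_semimodule_square:
  "complete_right_semimodule (square_act ract)"
proof -
  have 1: "ract (Sup Q) l = (SUP z\<in>Q. ract z l)" for Q l
    using ract_continuous_left unfolding lub_continuous_def by blast
  have 2: "ract u (Sup R) = (SUP m\<in>R. ract u m)" for u R
    using ract_continuous_right unfolding lub_continuous_def by blast
  show ?thesis
  proof
    show "lub_continuous (\<lambda>z. square_act ract z l)" for l
      unfolding lub_continuous_def
      by (simp add: square_act_def prod_eq_iff fst_Sup snd_Sup image_image 1)
    show "lub_continuous (square_act ract u)" for u
      unfolding lub_continuous_def
      by (simp add: square_act_def prod_eq_iff fst_Sup snd_Sup image_image 2)
  qed (simp_all add: square_act_def prod_eq_iff ract_add_left ract_add_right
      ract_mult ract_zero_right ract_zero_left ract_one)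
qed

definition pre_congruence ::
    "('x::complete_idem_monoid \<Rightarrow> 'k \<Rightarrow> 'x) \<Rightarrow> ('x \<times> 'x) set \<Rightarrow> bool" where
  "pre_congruence ract W \<longleftrightarrow>
    subsemimodule (square_act ract) W \<and>
    (\<forall>f. (f, f) \<in> W) \<and>
    (\<forall>f g h. (f, g) \<in> W \<and> (g, h) \<in> W \<longrightarrow> (f, h) \<in> W)"

definition polar_cone ::
    "('x::complete_idem_monoid \<Rightarrow> 'k \<Rightarrow> 'x) \<Rightarrow> ('x \<times> 'x) set \<Rightarrow> bool" where
  "polar_cone ract W \<longleftrightarrow> pre_congruence ract W \<and> (\<forall>f g. f \<le> g \<longrightarrow> (f, g) \<in> W)"

definition semimodule_congruence ::
    "('x::complete_idem_monoid \<Rightarrow> 'k \<Rightarrow> 'x) \<Rightarrow> ('x \<times> 'x) set \<Rightarrow> bool" where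
  "semimodule_congruence ract W \<longleftrightarrow>
    pre_congruence ract W \<and> (\<forall>f g. (f, g) \<in> W \<longrightarrow> (g, f) \<in> W)"

definition complete_polar_cone ::
    "('x::complete_idem_monoid \<Rightarrow> 'k \<Rightarrow> 'x) \<Rightarrow> ('x \<times> 'x) set \<Rightarrow> bool" where
  "complete_polar_cone ract W \<longleftrightarrow>
    polar_cone ract W \<and> complete_subsemimodule (square_act ract) W"

definition complete_congruence ::
    "('x::complete_idem_monoid \<Rightarrow> 'k \<Rightarrow> 'x) \<Rightarrow> ('x \<times> 'x) set \<Rightarrow> bool" where
  "complete_congruence ract W \<longleftrightarrow>
    semimodule_congruence ract W \<and> complete_subsemimodule (square_act ract) W"

definition polar_diamond :: "('y \<Rightarrow> 'x \<Rightarrow> 'k::order) \<Rightarrow> ('x \<times> 'x) set \<Rightarrow> 'y set" where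
  "polar_diamond bracket W = {y. \<forall>(f, g)\<in>W. bracket y f \<le> bracket y g}"

definition polar_circ :: "('y \<Rightarrow> 'x \<Rightarrow> 'k::order) \<Rightarrow> 'y set \<Rightarrow> ('x \<times> 'x) set" where
  "polar_circ bracket V = {(f, g). \<forall>y\<in>V. bracket y f \<le> bracket y g}"

definition polar_top :: "('y \<Rightarrow> 'x \<Rightarrow> 'k) \<Rightarrow> ('x \<times> 'x) set \<Rightarrow> 'y set" where
  "polar_top bracket W = {y. \<forall>(f, g)\<in>W. bracket y f = bracket y g}"

definition polar_bot :: "('y \<Rightarrow> 'x \<Rightarrow> 'k) \<Rightarrow> 'y set \<Rightarrow> ('x \<times> 'x) set" where
  "polar_bot bracket V = {(f, g). \<forall>y\<in>V. bracket y f = bracket y g}"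

end

theory Submission
  imports Defs
begin

text \<open>Continuity and linearity of the bracket make every set \<open>V\<^sup>\<circ>\<close> a complete polar cone and every
  set \<open>V\<^sup>\<bottom>\<close> a complete congruence. Conversely, the separation hypothesis says exactly that the
  bipolar of a complete polar cone (congruence) contains no point outside of it.\<close>

lemma idem_monoid_add_mono:
  fixes a b c d :: "'a::idem_monoid"
  assumes "a \<le> b" "c \<le> d"
  shows "a + c \<le> b + d"
  using assms unfolding le_iff_add_eq by (metis add.assoc add.commute)

lemma idem_semiring_mult_right_mono:
  fixes a b l :: "'k::idem_semiring"
  assumes "a \<le> b"
  shows "a * l \<le> b * l"
  using assms unfolding le_iff_add_eq by (metis distrib_right)

context pre_dual_pair
begin

text \<open>In the natural order \<open>f \<le> g\<close> means \<open>f + g = g\<close>, and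
  additivity in the second argument carries this equation over to the brackets. This places every
  pair with \<open>f \<le> g\<close> in a \<open>polar_circ\<close>.\<close>

lemma bracket_mono: "f \<le> g \<Longrightarrow> bracket y f \<le> bracket y g"
  unfolding le_iff_add_eq by (metis bracket_add_right)

lemma bracket_Sup: "bracket y (Sup Q) = (SUP x\<in>Q. bracket y x)"
  using bracket_continuous_right unfolding lub_continuous_def by blast

text \<open>For each fixed \<open>y\<close>, the defining inequality survives all the operations:
  addition and right multiplication in the semiring are monotone, suprema pass through the bracket,
  and inequalities chain. So \<open>V\<close> may be arbitrary.\<close>

lemma complete_polar_cone_polar_circ: "complete_polar_cone ract (polar_circ bracket V)"
proof -
  have sub: "subsemimodule (square_act ract) (polar_circ bracket V)"
    unfolding subsemimodule_def polar_circ_def square_act_def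
    by (auto simp: bracket_add_right bracket_ract
        intro!: idem_monoid_add_mono idem_semiring_mult_right_mono)
  have "Sup Q \<in> polar_circ bracket V" if "Q \<subseteq> polar_circ bracket V" for Q
  proof -
    \<comment> \<open>Suprema of pairs are componentwise, so both sides become suprema over the same
      index set \<open>Q\<close> and are compared term by term.\<close>
    have "bracket y (fst (Sup Q)) \<le> bracket y (snd (Sup Q))" if "y \<in> V" for y
      unfolding fst_Sup snd_Sup bracket_Sup image_image
      using \<open>Q \<subseteq> polar_circ bracket V\<close> \<open>y \<in> V\<close>
      by (intro SUP_subset_mono) (auto simp: polar_circ_def)
    then show ?thesis
      by (simp add: polar_circ_def case_prod_beta)
  qed
  with sub show ?thesis
    unfolding complete_polar_cone_def polar_cone_def pre_congruence_def
      complete_subsemimodule_def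
    by (auto simp: polar_circ_def bracket_mono intro: order_trans)
qed

text \<open>The argument for \<open>polar_circ\<close> carries over with equality in place of
  \<open>\<le>\<close>; the symmetry of equality makes the relation symmetric.\<close>

lemma complete_congruence_polar_bot: "complete_congruence ract (polar_bot bracket V)"
proof -
  have sub: "subsemimodule (square_act ract) (polar_bot bracket V)"
    unfolding subsemimodule_def polar_bot_def square_act_def
    by (auto simp: bracket_add_right bracket_ract)
  have "Sup Q \<in> polar_bot bracket V" if "Q \<subseteq> polar_bot bracket V" for Q
  proof -
    have "bracket y (fst (Sup Q)) = bracket y (snd (Sup Q))" if "y \<in> V" for y
      unfolding fst_Sup snd_Sup bracket_Sup image_image
      using \<open>Q \<subseteq> polar_bot bracket V\<close> \<open>y \<in> V\<close>
      by (intro SUP_cong) (auto simp: polar_bot_def)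
    then show ?thesis
      by (simp add: polar_bot_def case_prod_beta)
  qed
  with sub show ?thesis
    unfolding complete_congruence_def semimodule_congruence_def pre_congruence_def
      complete_subsemimodule_def
    by (auto simp: polar_bot_def)
qed

end

theorem theorem7:
  fixes lact :: "'k::complete_idem_semiring \<Rightarrow> 'y::complete_idem_monoid \<Rightarrow> 'y"
    and ract :: "'x::complete_idem_monoid \<Rightarrow> 'k \<Rightarrow> 'x"
    and bracket :: "'y \<Rightarrow> 'x \<Rightarrow> 'k"
  assumes "pre_dual_pair lact ract bracket"
  shows
    "((\<forall>W s t. complete_polar_cone ract W \<and> (s, t) \<notin> W \<longrightarrow>
         (\<exists>y. (\<forall>(f, g)\<in>W. bracket y f \<le> bracket y g) \<and> \<not> bracket y s \<le> bracket y t))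
      \<longrightarrow> (\<forall>W. subsemimodule (square_act ract) W \<longrightarrow>
            (complete_polar_cone ract W \<longleftrightarrow>
              W = polar_circ bracket (polar_diamond bracket W))))
     \<and>
     ((\<forall>W s t. complete_congruence ract W \<and> (s, t) \<notin> W \<longrightarrow>
         (\<exists>y. (\<forall>(f, g)\<in>W. bracket y f = bracket y g) \<and> bracket y s \<noteq> bracket y t))
      \<longrightarrow> (\<forall>W. subsemimodule (square_act ract) W \<longrightarrow>
            (complete_congruence ract W \<longleftrightarrow>
              W = polar_bot bracket (polar_top bracket W))))"
proof -
  interpret pre_dual_pair lact ract bracket
    by (fact assms)
  show ?thesis
  proof (intro conjI impI allI)
    fix W
    assume sep: "\<forall>W s t. complete_polar_cone ract W \<and> (s, t) \<notin> W \<longrightarrow>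
      (\<exists>y. (\<forall>(f, g)\<in>W. bracket y f \<le> bracket y g) \<and> \<not> bracket y s \<le> bracket y t)"
    have "W \<subseteq> polar_circ bracket (polar_diamond bracket W)"
      by (auto simp: polar_circ_def polar_diamond_def)
    \<comment> \<open>By contraposition: a \<open>y\<close> separating \<open>(s, t)\<close> from
      \<open>W\<close> belongs to \<open>polar_diamond bracket W\<close>, so it keeps
      \<open>(s, t)\<close> out of the bipolar.\<close>
    moreover have "polar_circ bracket (polar_diamond bracket W) \<subseteq> W"
      if "complete_polar_cone ract W"
      using sep that by (fastforce simp: polar_circ_def polar_diamond_def)
    \<comment> \<open>From right to left, the equation exhibits \<open>W\<close> as the polar of a
      subset of \<open>Y\<close>, hence as a complete polar cone.\<close>
    ultimately show "complete_polar_cone ract W \<longleftrightarrow>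
        W = polar_circ bracket (polar_diamond bracket W)"
      by (metis complete_polar_cone_polar_circ subset_antisym)
  next
    fix W
    assume sep: "\<forall>W s t. complete_congruence ract W \<and> (s, t) \<notin> W \<longrightarrow>
      (\<exists>y. (\<forall>(f, g)\<in>W. bracket y f = bracket y g) \<and> bracket y s \<noteq> bracket y t)"
    have "W \<subseteq> polar_bot bracket (polar_top bracket W)"
      by (auto simp: polar_bot_def polar_top_def)
    \<comment> \<open>The separating \<open>y\<close> now lies in
      \<open>polar_top bracket W\<close>.\<close>
    moreover have "polar_bot bracket (polar_top bracket W) \<subseteq> W"
      if "complete_congruence ract W"
      using sep that by (fastforce simp: polar_bot_def polar_top_def)
    ultimately show "complete_congruence ract W \<longleftrightarrow>
        W = polar_bot bracket (polar_top bracket W)"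
      by (metis complete_congruence_polar_bot subset_antisym)
  qed
qed

end
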